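(* Let $\mathcal{F} = \langle \mathbf{f}, \Theta, \Psi\rangle$ be a continuous dynamical system on $\mathbb{R}^n$ with polynomial vector field $\mathbf{f} = [f_1,\ldots,f_n]^T \in \mathbb{R}[\mathbf{x}]^n$, where $$\Psi=\{\mathbf{x}\in\mathbb{R}^n \mid \psi_1(\mathbf{x})\ge 0,\ldots,\psi_\kappa(\mathbf{x})\ge 0\},\qquad \Theta=\{\mathbf{x}\in\mathbb{R}^n \mid \theta_1(\mathbf{x})\ge 0,\ldots,\theta_\iota(\mathbf{x})\ge 0\}$$ are compact, and let $$\Xi=\{\mathbf{x}\in\mathbb{R}^n \mid \xi_1(\mathbf{x})\ge 0,\ldots,\xi_r(\mathbf{x})\ge 0\}$$ be a compact unsafe set, with all $\psi_j,\theta_i,\xi_i\in\mathbb{R}[\mathbf{x}]$. Let $B\in\mathbb{R}[\mathbf{x}]$ be a given polynomial and $d$ a positive integer. Suppose there exist sums of squares $\sigma_i\in\Sigma_d[\mathbf{x}]$ ($1\le i\le\iota$), $\phi_i\in\Sigma_d[\mathbf{x}]$ ($1\le i\le\kappa$), $\delta_i\in\Sigma_d[\mathbf{x}]$ ($1\le i\le r$), a polynomial $\lambda\in\mathbb{R}[\mathbf{x}]$ with $\deg(\lambda)\le 2d$, and positive real numbers $\epsilon_1,\epsilon_2$ such that 1. $-B(\mathbf{x})-\sum_{i=1}^{\iota}\sigma_i(\mathbf{x})\theta_i(\mathbf{x})\in\Sigma_d[\mathbf{x}]$, 2. $-\mathcal{L}_f B(\mathbf{x})+\lambda(\mathbf{x})B(\mathbf{x})-\sum_{i=1}^{\kappa}\phi_i(\mathbf{x})\psi_i(\mathbf{x})-\epsilon_1\in\Sigma_d[\mathbf{x}]$,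 3. $B(\mathbf{x})-\sum_{i=1}^{r}\delta_i(\mathbf{x})\xi_i(\mathbf{x})-\epsilon_2\in\Sigma_d[\mathbf{x}]$. Then $B$ is a barrier certificate of the system $\mathcal{F}$ with respect to $\Xi$, and $\mathcal{F}$ is safe with respect to $\Xi$.
   Context: Notation: $\mathbb{R}[\mathbf{x}]$ is the ring of real polynomials in $\mathbf{x}=[x_1,\ldots,x_n]^T$. $\Sigma_d[\mathbf{x}]$ is the set of sum-of-squares polynomials (finite sums $\sum_i h_i^2$ with $h_i\in\mathbb{R}[\mathbf{x}]$) of degree at most $2d$. The system $\mathcal{F}=\langle\mathbf{f},\Theta,\Psi\rangle$ consists of the ordinary differential equation $\dot{\mathbf{x}}=\mathbf{f}(\mathbf{x})$ on the domain $\Psi\subset\mathbb{R}^n$, with set of initial states $\Theta$. Lie derivative: $\mathcal{L}_f B(\mathbf{x})=\sum_{i=1}^n\frac{\partial B}{\partial x_i}(\mathbf{x})\,f_i(\mathbf{x})$. Safety: $\mathcal{F}$ is safe with respect to $\Xi$ if there do not exist $\mathbf{x}_0\in\Theta$, a time $t_1>0$, and a solution $\mathbf{x}(\cdot)$ of $\dot{\mathbf{x}}=\mathbf{f}(\mathbf{x})$ on $[0,t_1]$ with $\mathbf{x}(0)=\mathbf{x}_0$ such that $\mathbf{x}(t)\in\Psi$ for all $t\in[0,t_1]$ and $\mathbf{x}(t_1)\in\Xi$. Barrier certificate: a polynomial $B$ is a barrier certificate of $\mathcal{F}$ with respect to $\Xi$ if there is a polynomial $\lambda\in\mathbb{R}[\mathbf{x}]$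 such that (i) $B(\mathbf{x})\le 0$ for all $\mathbf{x}\in\Theta$; (ii) $\mathcal{L}_f B(\mathbf{x})-\lambda(\mathbf{x})B(\mathbf{x})<0$ for all $\mathbf{x}\in\Psi$; (iii) $B(\mathbf{x})>0$ for all $\mathbf{x}\in\Xi$. *)

theory Defs
  imports "HOL-Analysis.Analysis" "HOL-Library.Poly_Mapping"
begin

text \<open>
  Real polynomials in the variables \<open>x $ i\<close>, \<open>i :: 'n\<close>: finitely supported maps from monomials
  (exponent vectors) to coefficients, with the convolution product of \<^theory>\<open>HOL-Library.Poly_Mapping\<close>.
\<close>

type_synonym 'n rpoly = "('n \<Rightarrow>\<^sub>0 nat) \<Rightarrow>\<^sub>0 real"

definition const_poly :: "real \<Rightarrow> 'n rpoly" where
  "const_poly c = Poly_Mapping.single 0 c"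

definition eval_poly :: "'n::finite rpoly \<Rightarrow> real ^ 'n \<Rightarrow> real" where
  "eval_poly p x =
     (\<Sum>m\<in>Poly_Mapping.keys p.
        Poly_Mapping.lookup p m * (\<Prod>i\<in>UNIV. (x $ i) ^ Poly_Mapping.lookup m i))"

text \<open>Total degree; the zero polynomial gets degree \<open>0\<close>.\<close>

definition total_deg :: "'n::finite rpoly \<Rightarrow> nat" where
  "total_deg p =
     Max (insert 0 ((\<lambda>m. \<Sum>i\<in>UNIV. Poly_Mapping.lookup m i) ` Poly_Mapping.keys p))"

text \<open>
  Monomials not containing \<open>x $ i\<close> get coefficient \<open>0\<close>, so the truncated subtraction of exponents
  is harmless.
\<close>

definition partial_poly :: "'n \<Rightarrow> 'n rpoly \<Rightarrow> 'n rpoly" where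
  "partial_poly i p =
     (\<Sum>m\<in>Poly_Mapping.keys p.
        Poly_Mapping.single (m - Poly_Mapping.single i 1)
          (Poly_Mapping.lookup p m * real (Poly_Mapping.lookup m i)))"

definition lie_deriv :: "('n::finite rpoly) ^ 'n \<Rightarrow> 'n rpoly \<Rightarrow> 'n rpoly" where
  "lie_deriv f B = (\<Sum>i\<in>UNIV. partial_poly i B * f $ i)"

definition sos :: "nat \<Rightarrow> 'n::finite rpoly set" where
  "sos d = {p. (\<exists>(k::nat) h. p = (\<Sum>i<k. (h i)\<^sup>2)) \<and> total_deg p \<le> 2 * d}"

record 'n dyn_system =
  vfield :: "('n rpoly) ^ 'n"
  init_set :: "(real ^ 'n) set"
  dom_set :: "(real ^ 'n) set"

text \<open>The derivative at the endpoints \<open>0\<close> and \<open>T\<close> is one-sided.\<close>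

definition solution_on :: "('n::finite rpoly) ^ 'n \<Rightarrow> real \<Rightarrow> (real \<Rightarrow> real ^ 'n) \<Rightarrow> bool" where
  "solution_on f T x \<longleftrightarrow>
     (\<forall>t\<in>{0..T}. (x has_vector_derivative (\<chi> i. eval_poly (f $ i) (x t))) (at t within {0..T}))"

definition safe :: "'n::finite dyn_system \<Rightarrow> (real ^ 'n) set \<Rightarrow> bool" where
  "safe F \<Xi> \<longleftrightarrow>
     \<not> (\<exists>x0\<in>init_set F. \<exists>t1>0. \<exists>x. solution_on (vfield F) t1 x \<and> x 0 = x0 \<and>
          (\<forall>t\<in>{0..t1}. x t \<in> dom_set F) \<and> x t1 \<in> \<Xi>)"

definition barrier_certificate ::
  "'n::finite dyn_system \<Rightarrow> (real ^ 'n) set \<Rightarrow> 'n rpoly \<Rightarrow> bool" where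
  "barrier_certificate F \<Xi> B \<longleftrightarrow>
     (\<exists>lam :: 'n rpoly.
        (\<forall>x\<in>init_set F. eval_poly B x \<le> 0) \<and>
        (\<forall>x\<in>dom_set F. eval_poly (lie_deriv (vfield F) B) x - eval_poly lam x * eval_poly B x < 0) \<and>
        (\<forall>x\<in>\<Xi>. eval_poly B x > 0))"

end

theory Submission
  imports Defs
begin

text \<open>
  Sums of squares are pointwise nonnegative, so evaluating the three certificates at a point of
  \<open>\<Theta>\<close>, \<open>\<Psi>\<close> or \<open>\<Xi>\<close>, where the defining polynomials are nonnegative too, gives the three
  barrier inequalities, those on \<open>\<Psi>\<close> and \<open>\<Xi>\<close> strictly thanks to \<open>\<epsilon>1\<close> and \<open>\<epsilon>2\<close>; the multiplier \<open>\<lambda>\<close> of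
  the hypothesis is the one that the barrier certificate asks for. This rests on evaluation being a ring homomorphism
  (\<open>eval_poly_add\<close>, \<open>eval_poly_mult\<close>).

  For safety, follow \<open>g t = B (x t)\<close> along a trajectory that stays in \<open>\<Psi>\<close>. By the chain rule
  (\<open>eval_poly_along_solution\<close>) its derivative is the Lie derivative of \<open>B\<close> at \<open>x t\<close>. The term
  \<open>\<lambda> B\<close> vanishes wherever \<open>g\<close> does, so \<open>g\<close> has a negative derivative at each of its zeros and
  can never cross from nonpositive to positive values (\<open>nonpos_if_decreasing_at_zeros\<close>). Since
  \<open>g 0 \<le> 0\<close> on initial states and \<open>g > 0\<close> on unsafe states, no unsafe state is reached. Looking
  only at the zeros of \<open>g\<close> avoids the integrating factor \<open>exp (- \<integral>\<lambda>)\<close> of the Gronwall argument.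
\<close>

section \<open>Evaluation is a ring homomorphism\<close>

definition eval_monom :: "('n::finite \<Rightarrow>\<^sub>0 nat) \<Rightarrow> real ^ 'n \<Rightarrow> real" where
  "eval_monom m x = (\<Prod>i\<in>UNIV. (x $ i) ^ Poly_Mapping.lookup m i)"

lemma eval_monom_0 [simp]: "eval_monom 0 x = 1"
  by (simp add: eval_monom_def)

lemma eval_monom_add: "eval_monom (m + n) x = eval_monom m x * eval_monom n x"
  by (simp add: eval_monom_def lookup_add power_add prod.distrib)

lemma eval_poly_eq_sum_superset:
  assumes "finite S" "Poly_Mapping.keys p \<subseteq> S"
  shows "eval_poly p x = (\<Sum>m\<in>S. Poly_Mapping.lookup p m * eval_monom m x)"
  unfolding eval_poly_def eval_monom_def
  by (rule sum.mono_neutral_left) (use assms in \<open>auto simp: in_keys_iff\<close>)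

lemma eval_poly_0 [simp]: "eval_poly 0 x = 0"
  by (simp add: eval_poly_def)

lemma eval_poly_add: "eval_poly (p + q) x = eval_poly p x + eval_poly q x"
proof -
  let ?S = "Poly_Mapping.keys p \<union> Poly_Mapping.keys q"
  have "eval_poly h x = (\<Sum>m\<in>?S. Poly_Mapping.lookup h m * eval_monom m x)"
    if "h \<in> {p, q, p + q}" for h
    using that Poly_Mapping.keys_add[of p q] by (intro eval_poly_eq_sum_superset) auto
  then show ?thesis
    by (simp add: lookup_add distrib_right sum.distrib)
qed

lemma eval_poly_uminus: "eval_poly (- p) x = - eval_poly p x"
  using eval_poly_add[of p "- p" x] by simp

lemma eval_poly_diff: "eval_poly (p - q) x = eval_poly p x - eval_poly q x"
  using eval_poly_add[of p "- q" x] by (simp add: eval_poly_uminus)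

lemma eval_poly_sum: "eval_poly (\<Sum>i\<in>A. h i) x = (\<Sum>i\<in>A. eval_poly (h i) x)"
  by (induction A rule: infinite_finite_induct) (simp_all add: eval_poly_add)

lemma eval_poly_single: "eval_poly (Poly_Mapping.single m c) x = c * eval_monom m x"
  by (subst eval_poly_eq_sum_superset[where S = "{m}"]) auto

lemma eval_const_poly: "eval_poly (const_poly c) x = c"
  by (simp add: const_poly_def eval_poly_single)

lemma poly_eq_sum_single:
  "p = (\<Sum>m\<in>Poly_Mapping.keys p. Poly_Mapping.single m (Poly_Mapping.lookup p m))"
  by (rule poly_mapping_eqI) (auto simp: lookup_sum lookup_single when_def in_keys_iff)

text \<open>
  Multiplicativity on single terms is additivity of exponents; since both sides are additive in each
  factor, writing the factors as sums of single terms gives the general case.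
\<close>

lemma eval_poly_mult: "eval_poly (p * q) x = eval_poly p x * eval_poly q x"
proof -
  let ?c = Poly_Mapping.lookup and ?K = Poly_Mapping.keys
  have "p * q = (\<Sum>m\<in>?K p. Poly_Mapping.single m (?c p m)) *
      (\<Sum>n\<in>?K q. Poly_Mapping.single n (?c q n))"
    using poly_eq_sum_single by metis
  then have "eval_poly (p * q) x =
      (\<Sum>m\<in>?K p. \<Sum>n\<in>?K q. (?c p m * eval_monom m x) * (?c q n * eval_monom n x))"
    by (simp add: sum_product mult_single eval_poly_sum eval_poly_single eval_monom_add mult_ac)
  then show ?thesis
    by (simp add: eval_poly_def eval_monom_def sum_product)
qed

lemma eval_poly_sos_nonneg:
  assumes "p \<in> sos d"
  shows "eval_poly p x \<ge> 0"
  using assms by (auto simp: sos_def eval_poly_sum power2_eq_square eval_poly_mult intro!: sum_nonneg)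

section \<open>Polynomials along solutions\<close>

text \<open>
  This is the product rule over the variables. The subtraction of exponents truncates only when the
  variable \<open>i\<close> does not occur in \<open>m\<close>, and then the summand has the factor \<open>0\<close>.
\<close>

lemma eval_monom_has_real_derivative:
  fixes x :: "real \<Rightarrow> real ^ 'n::finite"
  assumes "(x has_vector_derivative v) (at t within S)"
  shows "((\<lambda>s. eval_monom m (x s)) has_real_derivative
    (\<Sum>i\<in>UNIV. real (Poly_Mapping.lookup m i) *
       eval_monom (m - Poly_Mapping.single i 1) (x t) * v $ i)) (at t within S)"
proof -
  let ?e = "Poly_Mapping.lookup m"
  have comp: "((\<lambda>s. x s $ i) has_real_derivative v $ i) (at t within S)" for i
    using bounded_linear.has_vector_derivative[OF bounded_linear_vec_nth assms]
    by (simp add: has_real_derivative_iff_has_vector_derivative)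
  have fac: "((\<lambda>s. (x s $ i) ^ ?e i) has_real_derivative
      real (?e i) * (x t $ i) ^ (?e i - 1) * v $ i) (at t within S)" for i
    using DERIV_power[OF comp, of i "?e i"] by (simp add: mult_ac)
  have drop: "eval_monom (m - Poly_Mapping.single i 1) (x t) =
      (x t $ i) ^ (?e i - 1) * (\<Prod>j\<in>UNIV - {i}. (x t $ j) ^ ?e j)" for i
    unfolding eval_monom_def
    by (subst prod.remove[of UNIV i]) (auto simp: lookup_minus lookup_single when_def intro!: prod.cong)
  show ?thesis
    unfolding drop
    unfolding eval_monom_def
    using has_derivative_prod[where I = UNIV and f = "\<lambda>i s. (x s $ i) ^ ?e i",
        OF fac[unfolded has_field_derivative_def]]
    unfolding has_field_derivative_def
    by (rule has_derivative_eq_rhs)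
      (simp add: fun_eq_iff sum_distrib_left sum_distrib_right mult_ac)
qed

lemma eval_poly_has_real_derivative:
  fixes x :: "real \<Rightarrow> real ^ 'n::finite"
  assumes "(x has_vector_derivative v) (at t within S)"
  shows "((\<lambda>s. eval_poly p (x s)) has_real_derivative
    (\<Sum>i\<in>UNIV. eval_poly (partial_poly i p) (x t) * v $ i)) (at t within S)"
proof -
  let ?c = "Poly_Mapping.lookup p"
  have "((\<lambda>s. \<Sum>m\<in>Poly_Mapping.keys p. ?c m * eval_monom m (x s)) has_real_derivative
      (\<Sum>m\<in>Poly_Mapping.keys p. ?c m * (\<Sum>i\<in>UNIV. real (Poly_Mapping.lookup m i) *
         eval_monom (m - Poly_Mapping.single i 1) (x t) * v $ i))) (at t within S)"
    by (intro DERIV_sum DERIV_cmult eval_monom_has_real_derivative assms)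
  moreover have "(\<Sum>m\<in>Poly_Mapping.keys p. ?c m * (\<Sum>i\<in>UNIV. real (Poly_Mapping.lookup m i) *
         eval_monom (m - Poly_Mapping.single i 1) (x t) * v $ i)) =
      (\<Sum>i\<in>UNIV. eval_poly (partial_poly i p) (x t) * v $ i)"
    unfolding partial_poly_def eval_poly_sum eval_poly_single sum_distrib_left sum_distrib_right
    by (subst sum.swap) (simp add: mult_ac)
  ultimately show ?thesis
    by (simp add: eval_poly_def eval_monom_def)
qed

lemma eval_poly_along_solution:
  assumes "solution_on f T x" "t \<in> {0..T}"
  shows "((\<lambda>s. eval_poly B (x s)) has_real_derivative eval_poly (lie_deriv f B) (x t))
    (at t within {0..T})"
  using eval_poly_has_real_derivative[of x "\<chi> i. eval_poly (f $ i) (x t)" t "{0..T}" B] assms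
  by (simp add: solution_on_def lie_deriv_def eval_poly_sum eval_poly_mult)

section \<open>Barrier certificates imply safety\<close>

text \<open>
  If \<open>g\<close> ended positive, it would vanish at the last time \<open>s\<close> with \<open>g s \<le> 0\<close> and be positive right
  after it, which the negative derivative at \<open>s\<close> forbids.
\<close>

lemma nonpos_if_decreasing_at_zeros:
  fixes g g' :: "real \<Rightarrow> real"
  assumes "0 \<le> T" "g 0 \<le> 0"
    and deriv: "\<And>t. t \<in> {0..T} \<Longrightarrow> (g has_real_derivative g' t) (at t within {0..T})"
    and neg: "\<And>t. t \<in> {0..T} \<Longrightarrow> g t = 0 \<Longrightarrow> g' t < 0"
  shows "g T \<le> 0"
proof (rule ccontr)
  assume "\<not> g T \<le> 0"
  have cont: "continuous_on {0..T} g"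
    using deriv by (meson DERIV_continuous continuous_on_eq_continuous_within)
  let ?A = "{t \<in> {0..T}. g t \<le> 0}"
  define s where "s = Sup ?A"
  have "closed ?A"
    using continuous_on_closed_Collect_le[OF cont continuous_on_const] by simp
  have "?A \<noteq> {}" "bdd_above ?A"
    using assms by (auto intro!: bdd_aboveI[of _ T])
  then have "s \<in> ?A"
    unfolding s_def using \<open>closed ?A\<close> by (intro closed_contains_Sup)
  have after: "g t > 0" if "s < t" "t \<le> T" for t
    using that \<open>s \<in> ?A\<close> cSup_upper[of t ?A] \<open>bdd_above ?A\<close> unfolding s_def by force
  have "s < T"
    using \<open>s \<in> ?A\<close> \<open>\<not> g T \<le> 0\<close> by (cases "s = T") auto
  have "g s = 0"
  proof (rule ccontr)
    assume "g s \<noteq> 0"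
    have "\<exists>t\<ge>s. t \<le> T \<and> g t = 0"
      using \<open>s \<in> ?A\<close> \<open>\<not> g T \<le> 0\<close> \<open>s < T\<close>
      by (intro IVT' continuous_on_subset[OF cont]) auto
    then obtain t where "s \<le> t" "t \<le> T" "g t = 0"
      by blast
    with after[of t] \<open>g s \<noteq> 0\<close> show False
      by (cases "s = t") auto
  qed
  have "\<exists>e>0. \<forall>h>0. s + h \<in> {0..T} \<longrightarrow> h < e \<longrightarrow> g s > g (s + h)"
    using \<open>s \<in> ?A\<close> \<open>g s = 0\<close> by (intro has_real_derivative_neg_dec_right[OF deriv neg]) auto
  then obtain e where "e > 0" and
    e: "\<And>h. h > 0 \<Longrightarrow> s + h \<in> {0..T} \<Longrightarrow> h < e \<Longrightarrow> g (s + h) < g s"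
    by blast
  define h where "h = min (e / 2) (T - s)"
  have "h > 0" "h < e" "s + h \<le> T"
    using \<open>e > 0\<close> \<open>s < T\<close> by (auto simp: h_def min_def)
  then have "g (s + h) < 0"
    using e[of h] \<open>s \<in> ?A\<close> \<open>g s = 0\<close> by simp
  with after[of "s + h"] \<open>h > 0\<close> \<open>s + h \<le> T\<close> show False
    by simp
qed

lemma barrier_certificate_imp_safe:
  assumes "barrier_certificate F \<Xi> B"
  shows "safe F \<Xi>"
  unfolding safe_def
proof (intro notI, elim bexE exE conjE)
  fix x0 t1 x
  assume x0: "x0 \<in> init_set F" "x 0 = x0" and "t1 > (0::real)"
    and sol: "solution_on (vfield F) t1 x"
    and dom: "\<forall>t\<in>{0..t1}. x t \<in> dom_set F" and unsafe: "x t1 \<in> \<Xi>"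
  obtain lam where init: "\<forall>x\<in>init_set F. eval_poly B x \<le> 0"
    and lie: "\<forall>x\<in>dom_set F.
      eval_poly (lie_deriv (vfield F) B) x - eval_poly lam x * eval_poly B x < 0"
    and pos: "\<forall>x\<in>\<Xi>. eval_poly B x > 0"
    using assms unfolding barrier_certificate_def by blast
  have "eval_poly B (x t1) \<le> 0"
  proof (rule nonpos_if_decreasing_at_zeros
      [where g = "\<lambda>t. eval_poly B (x t)" and g' = "\<lambda>t. eval_poly (lie_deriv (vfield F) B) (x t)"])
    show "eval_poly (lie_deriv (vfield F) B) (x t) < 0"
      if "t \<in> {0..t1}" "eval_poly B (x t) = 0" for t
      using lie dom that by fastforce
  qed (use \<open>t1 > 0\<close> x0 init eval_poly_along_solution[OF sol] in auto)
  with pos unsafe show False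
    by fastforce
qed

section \<open>Sum-of-squares certificates\<close>

text \<open>
  The easy direction of a Positivstellensatz: a polynomial in the quadratic module generated by the
  constraints is nonnegative where all the constraints are.
\<close>

lemma eval_poly_nonneg_if_sos_certificate:
  assumes "p - (\<Sum>i\<in>I. \<sigma> i * q i) \<in> sos d"
    and "\<And>i. i \<in> I \<Longrightarrow> \<sigma> i \<in> sos d" "\<And>i. i \<in> I \<Longrightarrow> eval_poly (q i) x \<ge> 0"
  shows "eval_poly p x \<ge> 0"
proof -
  have "0 \<le> (\<Sum>i\<in>I. eval_poly (\<sigma> i) x * eval_poly (q i) x)"
    using assms(3) by (intro sum_nonneg mult_nonneg_nonneg eval_poly_sos_nonneg[OF assms(2)])
  also have "\<dots> \<le> eval_poly p x"
    using eval_poly_sos_nonneg[OF assms(1), of x]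
    by (simp add: eval_poly_diff eval_poly_sum eval_poly_mult)
  finally show ?thesis .
qed

theorem theorem3p2:
  fixes f :: "('n::finite rpoly) ^ 'n"
    and \<psi> \<theta> \<xi> :: "nat \<Rightarrow> 'n rpoly"
    and \<kappa> \<iota> r d :: nat
    and \<Psi> \<Theta> \<Xi> :: "(real ^ 'n) set"
    and B :: "'n rpoly"
    and F :: "'n dyn_system"
  assumes "\<Psi> = {x. \<forall>j\<in>{1..\<kappa>}. eval_poly (\<psi> j) x \<ge> 0}"
    and "\<Theta> = {x. \<forall>j\<in>{1..\<iota>}. eval_poly (\<theta> j) x \<ge> 0}"
    and "\<Xi> = {x. \<forall>j\<in>{1..r}. eval_poly (\<xi> j) x \<ge> 0}"
    and "compact \<Psi>" and "compact \<Theta>" and "compact \<Xi>"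
    and "F = \<lparr>vfield = f, init_set = \<Theta>, dom_set = \<Psi>\<rparr>"
    and "d > 0"
    and "\<exists>(\<sigma> :: nat \<Rightarrow> 'n rpoly) (\<phi> :: nat \<Rightarrow> 'n rpoly) (\<delta> :: nat \<Rightarrow> 'n rpoly)
           (lam :: 'n rpoly) (\<epsilon>1 :: real) (\<epsilon>2 :: real).
           (\<forall>i\<in>{1..\<iota>}. \<sigma> i \<in> sos d) \<and> (\<forall>i\<in>{1..\<kappa>}. \<phi> i \<in> sos d) \<and> (\<forall>i\<in>{1..r}. \<delta> i \<in> sos d) \<and>
           total_deg lam \<le> 2 * d \<and> \<epsilon>1 > 0 \<and> \<epsilon>2 > 0 \<and>
           - B - (\<Sum>i=1..\<iota>. \<sigma> i * \<theta> i) \<in> sos d \<and>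
           - lie_deriv f B + lam * B - (\<Sum>i=1..\<kappa>. \<phi> i * \<psi> i) - const_poly \<epsilon>1 \<in> sos d \<and>
           B - (\<Sum>i=1..r. \<delta> i * \<xi> i) - const_poly \<epsilon>2 \<in> sos d"
  shows "barrier_certificate F \<Xi> B \<and> safe F \<Xi>"
proof -
  obtain \<sigma> \<phi> \<delta> lam \<epsilon>1 \<epsilon>2 where eps: "\<epsilon>1 > 0" "\<epsilon>2 > 0"
    and sos: "\<forall>i\<in>{1..\<iota>}. \<sigma> i \<in> sos d" "\<forall>i\<in>{1..\<kappa>}. \<phi> i \<in> sos d" "\<forall>i\<in>{1..r}. \<delta> i \<in> sos d"
    and init: "- B - (\<Sum>i=1..\<iota>. \<sigma> i * \<theta> i) \<in> sos d"
    and lie: "- lie_deriv f B + lam * B - (\<Sum>i=1..\<kappa>. \<phi> i * \<psi> i) - const_poly \<epsilon>1 \<in> sos d"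
    and unsafe: "B - (\<Sum>i=1..r. \<delta> i * \<xi> i) - const_poly \<epsilon>2 \<in> sos d"
    using assms(9) by blast
  have "eval_poly B x \<le> 0" if "x \<in> \<Theta>" for x
    using eval_poly_nonneg_if_sos_certificate[OF init, of x] that sos assms(2)
    by (simp add: eval_poly_uminus)
  moreover have "eval_poly (lie_deriv f B) x - eval_poly lam x * eval_poly B x < 0"
    if "x \<in> \<Psi>" for x
  proof -
    have "(- lie_deriv f B + lam * B - const_poly \<epsilon>1) - (\<Sum>i=1..\<kappa>. \<phi> i * \<psi> i) \<in> sos d"
      using lie by (simp add: algebra_simps)
    from eval_poly_nonneg_if_sos_certificate[OF this, of x] show ?thesis
      using that sos assms(1) eps
      by (simp add: eval_poly_uminus eval_poly_add eval_poly_diff eval_poly_mult eval_const_poly)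
  qed
  moreover have "eval_poly B x > 0" if "x \<in> \<Xi>" for x
  proof -
    have "(B - const_poly \<epsilon>2) - (\<Sum>i=1..r. \<delta> i * \<xi> i) \<in> sos d"
      using unsafe by (simp add: algebra_simps)
    from eval_poly_nonneg_if_sos_certificate[OF this, of x] show ?thesis
      using that sos assms(3) eps by (simp add: eval_poly_diff eval_const_poly)
  qed
  ultimately have "barrier_certificate F \<Xi> B"
    unfolding barrier_certificate_def assms(7) by auto
  then show ?thesis
    using barrier_certificate_imp_safe by blast
qed

end
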